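(* Let $\varepsilon>0$ be a real number and let $n,a,b$ be positive integers. If $(1+\varepsilon)\ln n\le a<\frac{n}{2e}$ and $$b\ge \frac{2a\left(n-2+\ln\left\lceil \frac{n}{2a}\right\rceil\right)+\ln\left\lceil \frac{n}{2a}\right\rceil-1+\frac{2a}{n}}{2a+\ln\left\lceil \frac{n}{2a}\right\rceil-1+\frac{2a}{n}},$$ then the $(a:b)$ Maker-Breaker Connectivity game $\mathcal{T}_n$ is Breaker's win.
   Context: In the $(a:b)$ Maker-Breaker Connectivity game $\mathcal{T}_n$, the board is the edge set of the complete graph $K_n$. Two players, Maker and Breaker, alternately claim previously unclaimed edges, Breaker going first; in each turn Breaker claims $b$ edges and then Maker claims $a$ edges, until every edge is claimed. Maker wins if, by the end of the game, the graph of his edges is a connected spanning subgraph of $K_n$; otherwise Breaker wins. The game is Breaker's win if Breaker has a strategy that wins against every strategy of Maker. $\ln$ denotes the natural logarithm. *)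

theory Defs
  imports Complex_Main
begin

definition complete_edges :: "nat \<Rightarrow> nat set set" where
  "complete_edges n = {e. e \<subseteq> {..<n} \<and> card e = 2}"

definition connected_graph :: "'v set \<Rightarrow> 'v set set \<Rightarrow> bool" where
  "connected_graph V E \<longleftrightarrow> (\<forall>u\<in>V. \<forall>v\<in>V. (u, v) \<in> {(x, y). {x, y} \<in> E}\<^sup>*)"

text \<open>
  A history is the list of all moves so far in chronological order, a move being the set of
  elements claimed in one turn. Breaker moves first, so the moves at even indices are Breaker's
  and those at odd indices are Maker's.
\<close>

type_synonym 'e history = "'e set list"

definition unclaimed :: "'e set \<Rightarrow> 'e history \<Rightarrow> 'e set" where
  "unclaimed X h = X - \<Union>(set h)"

definition maker_claimed :: "'e history \<Rightarrow> 'e set" where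
  "maker_claimed h = \<Union>{h ! i | i. i < length h \<and> odd i}"

text \<open>
  A strategy for the player with bias \<open>k\<close> on the board \<open>X\<close> claims exactly \<open>k\<close> unclaimed elements,
  or all of them if fewer than \<open>k\<close> are left (this happens only when the board is being exhausted).
  The condition is imposed on all histories, including those that no play produces; this
  is no restriction, as the values of a strategy there are irrelevant.
\<close>

definition legal_strategy :: "'e set \<Rightarrow> nat \<Rightarrow> ('e history \<Rightarrow> 'e set) \<Rightarrow> bool" where
  "legal_strategy X k s \<longleftrightarrow>
    (\<forall>h. s h \<subseteq> unclaimed X h \<and> card (s h) = min k (card (unclaimed X h)))"

text \<open>The first \<open>i\<close> moves when Breaker follows \<open>\<beta>\<close> and Maker follows \<open>\<mu>\<close>.\<close>

primrec play ::
  "('e history \<Rightarrow> 'e set) \<Rightarrow> ('e history \<Rightarrow> 'e set) \<Rightarrow> nat \<Rightarrow> 'e history" where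
  "play \<beta> \<mu> 0 = []"
| "play \<beta> \<mu> (Suc i) = play \<beta> \<mu> i @ [(if even i then \<beta> else \<mu>) (play \<beta> \<mu> i)]"

text \<open>
  The \<open>(a:b)\<close> game on the board \<open>X\<close> in which \<open>W\<close> holds of the final sets of Maker that are
  winning for him. The choice of a number \<open>i\<close> of moves that exhausts the board does not matter:
  once the board is exhausted, all further moves are empty.
\<close>

definition breakers_win :: "'e set \<Rightarrow> ('e set \<Rightarrow> bool) \<Rightarrow> nat \<Rightarrow> nat \<Rightarrow> bool" where
  "breakers_win X W a b \<longleftrightarrow>
    (\<exists>\<beta>. legal_strategy X b \<beta> \<and>
      (\<forall>\<mu>. legal_strategy X a \<mu> \<longrightarrow>
        (\<exists>i. unclaimed X (play \<beta> \<mu> i) = {} \<and> \<not> W (maker_claimed (play \<beta> \<mu> i)))))"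

definition connectivity_game_breakers_win :: "nat \<Rightarrow> nat \<Rightarrow> nat \<Rightarrow> bool" where
  "connectivity_game_breakers_win n a b \<longleftrightarrow>
    breakers_win (complete_edges n) (connected_graph {..<n}) a b"

end

theory Submission
  imports Defs
begin

text \<open>
  Breaker isolates a vertex as in the Chvatal--Erdos box game. With \<open>r = \<lceil>n / 2a\<rceil> - 1\<close>,
  he keeps, \<open>j\<close> rounds before his last move, a set \<open>S\<close> of \<open>2aj + 1\<close> vertices not touched by
  Maker, and claims edges one at a time at a vertex of \<open>S\<close> where his degree is smallest, so that
  his degrees on \<open>S\<close> stay balanced. His \<open>b\<close> edges raise the average degree on \<open>S\<close> by at
  least \<open>b / |S|\<close>. Maker then touches at most \<open>2a\<close> vertices; by balance, discarding \<open>2a\<close>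
  vertices lowers the average by at most \<open>2a / |S|\<close>. Finally a single vertex is left, of degree
  at least \<open>\<Sum>j=1..r. (b - 2a) / (2aj + 1)\<close>, and the bound on \<open>b\<close> makes this exceed
  \<open>n - 2 - b\<close>, so that Breaker can claim all its missing edges at once.
\<close>

section \<open>From strategies on histories to a round-by-round invariant\<close>

lemma unclaimed_snoc: "unclaimed X (h @ [c]) = unclaimed X h - c"
  by (auto simp: unclaimed_def)

definition breaker_claimed :: "'e history \<Rightarrow> 'e set" where
  "breaker_claimed h = \<Union>{h ! i | i. i < length h \<and> even i}"

lemma maker_claimed_snoc:
  "maker_claimed (h @ [c]) = (if odd (length h) then maker_claimed h \<union> c else maker_claimed h)"
proof -
  have *: "maker_claimed h' = (\<Union>i\<in>{i. i < length h' \<and> odd i}. h' ! i)" for h' :: "'a history"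
    by (auto simp: maker_claimed_def)
  have "{i. i < length (h @ [c]) \<and> odd i}
      = {i. i < length h \<and> odd i} \<union> (if odd (length h) then {length h} else {})"
    by (auto simp: less_Suc_eq)
  then show ?thesis
    unfolding * by (simp only: UN_Un) (auto simp: nth_append)
qed

lemma breaker_claimed_snoc:
  "breaker_claimed (h @ [c]) = (if even (length h) then breaker_claimed h \<union> c else breaker_claimed h)"
proof -
  have *: "breaker_claimed h' = (\<Union>i\<in>{i. i < length h' \<and> even i}. h' ! i)" for h' :: "'a history"
    by (auto simp: breaker_claimed_def)
  have "{i. i < length (h @ [c]) \<and> even i}
      = {i. i < length h \<and> even i} \<union> (if even (length h) then {length h} else {})"
    by (auto simp: less_Suc_eq)
  then show ?thesis
    unfolding * by (simp only: UN_Un) (auto simp: nth_append)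
qed

lemma claimed_Nil [simp]: "breaker_claimed [] = {}" "maker_claimed [] = {}"
  by (auto simp: breaker_claimed_def maker_claimed_def)

lemma unclaimed_eq: "unclaimed X h = X - (breaker_claimed h \<union> maker_claimed h)"
proof (induction h rule: rev_induct)
  case Nil
  show ?case by (simp add: unclaimed_def)
next
  case (snoc c h)
  then show ?case by (auto simp: unclaimed_snoc maker_claimed_snoc breaker_claimed_snoc)
qed

lemma length_play [simp]: "length (play \<beta> \<mu> i) = i"
  by (induction i) auto

text \<open>Choosing in every round an answer that preserves \<open>P\<close> gives Breaker's
  strategy, and as \<open>b > 0\<close> every round shrinks the free part of the board until nothing
  is left. \<open>P i B M\<close> describes the position after \<open>i\<close> full rounds, which
  keeps histories out of the game argument itself.\<close>

lemma breakers_win_by_invariant: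
  fixes P :: "nat \<Rightarrow> 'e set \<Rightarrow> 'e set \<Rightarrow> bool"
  assumes fin: "finite X" and b: "b > 0"
    and init: "P 0 {} {}"
    and step: "\<And>i B M. P i B M \<Longrightarrow> B \<subseteq> X \<Longrightarrow> M \<subseteq> X \<Longrightarrow> B \<inter> M = {} \<Longrightarrow>
      \<exists>C. C \<subseteq> X - (B \<union> M) \<and> card C = min b (card (X - (B \<union> M))) \<and>
        (\<forall>D. D \<subseteq> X - (B \<union> M \<union> C) \<longrightarrow> card D \<le> a \<longrightarrow> P (Suc i) (B \<union> C) (M \<union> D))"
    and final: "\<And>i B M. R \<le> i \<Longrightarrow> P i B M \<Longrightarrow> B \<union> M = X \<Longrightarrow> B \<inter> M = {} \<Longrightarrow> \<not> W M"
  shows "breakers_win X W a b"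
proof -
  define legal where "legal = (\<lambda>h C. C \<subseteq> unclaimed X h \<and> card C = min b (card (unclaimed X h)))"
  define good where "good = (\<lambda>h C. legal h C \<and>
    (\<forall>D. D \<subseteq> unclaimed X h - C \<longrightarrow> card D \<le> a \<longrightarrow>
      P (Suc (length h div 2)) (breaker_claimed h \<union> C) (maker_claimed h \<union> D)))"
  \<comment> \<open>Legality is demanded on every history, so where no good answer exists the
    strategy falls back on an arbitrary legal one.\<close>
  define \<beta> where "\<beta> = (\<lambda>h. if \<exists>C. good h C then SOME C. good h C else SOME C. legal h C)"
  have ex_legal: "\<exists>C. legal h C" for h
  proof -
    have "finite (unclaimed X h)"
      using fin by (simp add: unclaimed_def)
    then show ?thesis
      unfolding legal_def by (metis min.cobounded2 obtain_subset_with_card_n)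
  qed
  have good_\<beta>: "good h (\<beta> h)" if "\<exists>C. good h C" for h
    using that someI_ex[OF that] by (simp add: \<beta>_def)
  have legal_\<beta>: "legal h (\<beta> h)" for h
  proof (cases "\<exists>C. good h C")
    case True
    then show ?thesis using good_\<beta> good_def by blast
  next
    case False
    then show ?thesis using someI_ex[OF ex_legal[of h]] unfolding \<beta>_def by (simp only: if_False)
  qed
  have strat_\<beta>: "legal_strategy X b \<beta>"
    using legal_\<beta> by (simp add: legal_strategy_def legal_def)
  have "\<exists>i. unclaimed X (play \<beta> \<mu> i) = {} \<and> \<not> W (maker_claimed (play \<beta> \<mu> i))"
    if \<mu>: "legal_strategy X a \<mu>" for \<mu>
  proof -
    \<comment> \<open>\<open>h i\<close> is the history after \<open>i\<close> full rounds; the next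
      round consists of \<open>C i\<close> and then \<open>D i\<close>.\<close>
    define h where "h = (\<lambda>i. play \<beta> \<mu> (2 * i))"
    have h_Suc: "h (Suc i) = (h i @ [\<beta> (h i)]) @ [\<mu> (h i @ [\<beta> (h i)])]" for i
      by (simp add: h_def)
    have len: "length (h i) = 2 * i" for i
      by (simp add: h_def)
    define B where "B = (\<lambda>i. breaker_claimed (h i))"
    define M where "M = (\<lambda>i. maker_claimed (h i))"
    define C where "C = (\<lambda>i. \<beta> (h i))"
    define D where "D = (\<lambda>i. \<mu> (h i @ [\<beta> (h i)]))"
    have B0: "B 0 = {}" and M0: "M 0 = {}"
      by (simp_all add: B_def M_def h_def)
    have BS: "B (Suc i) = B i \<union> C i" and MS: "M (Suc i) = M i \<union> D i" for i
      unfolding B_def M_def C_def D_def h_Suc maker_claimed_snoc breaker_claimed_snoc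
      by (simp_all add: len)
    have unc: "unclaimed X (h i) = X - (B i \<union> M i)" for i
      by (simp add: B_def M_def unclaimed_eq)
    have C: "C i \<subseteq> X - (B i \<union> M i)" "card (C i) = min b (card (X - (B i \<union> M i)))" for i
      using legal_\<beta>[of "h i"] by (auto simp: legal_def unc C_def)
    have D: "D i \<subseteq> X - (B i \<union> M i) - C i" "card (D i) \<le> a" for i
    proof -
      have "D i \<subseteq> unclaimed X (h i @ [\<beta> (h i)])
          \<and> card (D i) = min a (card (unclaimed X (h i @ [\<beta> (h i)])))"
        using \<mu> unfolding D_def legal_strategy_def by blast
      then show "D i \<subseteq> X - (B i \<union> M i) - C i" "card (D i) \<le> a"
        by (auto simp: unclaimed_snoc unc C_def)
    qed
    have inv: "P i (B i) (M i) \<and> B i \<subseteq> X \<and> M i \<subseteq> X \<and> B i \<inter> M i = {}" for i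
    proof (induction i)
      case 0
      then show ?case using init by (simp add: B0 M0)
    next
      case (Suc i)
      obtain C' where "C' \<subseteq> X - (B i \<union> M i)" "card C' = min b (card (X - (B i \<union> M i)))"
        "\<forall>D. D \<subseteq> X - (B i \<union> M i \<union> C') \<longrightarrow> card D \<le> a \<longrightarrow> P (Suc i) (B i \<union> C') (M i \<union> D)"
        using step[of i "B i" "M i"] Suc by (elim conjE exE) auto
      then have "good (h i) C'"
        unfolding good_def legal_def unc len B_def[symmetric] M_def[symmetric]
        by (simp add: Diff_eq Int_assoc B_def M_def)
      then have "good (h i) (C i)"
        using good_\<beta> unfolding C_def by blast
      then have "P (Suc i) (B i \<union> C i) (M i \<union> D i)"
        using D[of i] unfolding good_def unc len by (simp add: B_def M_def)
      then show ?case
        using Suc C[of i] D[of i] unfolding BS MS by blast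
    qed
    have left: "card (X - (B i \<union> M i)) \<le> card X - i" for i
    proof (induction i)
      case 0
      then show ?case by (simp add: B0 M0)
    next
      case (Suc i)
      have "card (X - (B (Suc i) \<union> M (Suc i))) \<le> card (X - (B i \<union> M i) - C i)"
        using fin by (intro card_mono) (auto simp: BS MS)
      also have "\<dots> = card (X - (B i \<union> M i)) - card (C i)"
        using C(1) fin by (intro card_Diff_subset) (auto intro: finite_subset)
      also have "\<dots> \<le> card X - Suc i"
        using C(2)[of i] Suc b by auto
      finally show ?case .
    qed
    \<comment> \<open>\<open>card X\<close> rounds exhaust the board, and at least \<open>R\<close>
      rounds are needed to apply \<open>final\<close>.\<close>
    define k where "k = R + card X"
    have "card (X - (B k \<union> M k)) = 0"
      using left[of k] by (simp add: k_def)
    then have empty: "X - (B k \<union> M k) = {}"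
      using fin by simp
    then have "\<not> W (M k)"
      using inv[of k] by (intro final[of k "B k"]) (auto simp: k_def)
    then show ?thesis
      using empty unc[of k] unfolding h_def M_def by metis
  qed
  then show ?thesis
    unfolding breakers_win_def using strat_\<beta> by blast
qed

section \<open>Degrees, isolated vertices and balanced loads\<close>

definition degree :: "'v set set \<Rightarrow> 'v \<Rightarrow> nat" where
  "degree E v = card {e \<in> E. v \<in> e}"

lemma degree_mono: "finite F \<Longrightarrow> E \<subseteq> F \<Longrightarrow> degree E v \<le> degree F v"
  unfolding degree_def by (rule card_mono) auto

lemma degree_insert: "finite E \<Longrightarrow> e \<notin> E \<Longrightarrow> v \<in> e \<Longrightarrow> degree (insert e E) v = Suc (degree E v)"
proof -
  assume "finite E" "e \<notin> E" "v \<in> e"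
  moreover have "{f \<in> insert e E. v \<in> f} = insert e {f \<in> E. v \<in> f}"
    using \<open>v \<in> e\<close> by auto
  ultimately show ?thesis
    by (simp add: degree_def)
qed

lemma finite_complete_edges: "finite (complete_edges n)"
  unfolding complete_edges_def by (rule finite_subset[of _ "Pow {..<n}"]) auto

lemma degree_complete_edges:
  assumes "v < n"
  shows "degree (complete_edges n) v = n - 1"
proof -
  have "{e \<in> complete_edges n. v \<in> e} = (\<lambda>u. {v, u}) ` ({..<n} - {v})"
    using assms by (auto simp: complete_edges_def card_2_iff)
  moreover have "inj_on (\<lambda>u. {v, u}) ({..<n} - {v})"
    by (auto simp: inj_on_def doubleton_eq_iff)
  ultimately show ?thesis
    using assms by (simp add: degree_def card_image)
qed

lemma not_connected_if_isolated:
  assumes "v \<in> V" "u \<in> V" "u \<noteq> v" "\<And>e. e \<in> E \<Longrightarrow> v \<notin> e"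
  shows "\<not> connected_graph V E"
proof
  assume "connected_graph V E"
  then have "(v, u) \<in> {(x, y). {x, y} \<in> E}\<^sup>*"
    using assms(1,2) by (simp add: connected_graph_def)
  then show False
    using assms(3,4) by (cases rule: converse_rtranclE) auto
qed

text \<open>
  The degrees on \<open>S\<close> dominate pointwise a distribution of \<open>N\<close> units over \<open>S\<close> that is as even
  as possible: \<open>s\<close> vertices get \<open>t + 1\<close> units, the others \<open>t\<close>. Only lower bounds are recorded
  because an edge between two vertices of \<open>S\<close> is counted at one of them only.
\<close>

definition evenly_loaded :: "'v set set \<Rightarrow> 'v set \<Rightarrow> nat \<Rightarrow> bool" where
  "evenly_loaded E S N \<longleftrightarrow> (\<exists>t s. N = t * card S + s \<and> s < card S \<and>
    (\<forall>v\<in>S. t \<le> degree E v) \<and> s \<le> card {v \<in> S. t < degree E v})"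

lemma evenly_loaded_mono:
  assumes "evenly_loaded E S N" "E \<subseteq> F" "finite F" "finite S"
  shows "evenly_loaded F S N"
proof -
  obtain t s where ts: "N = t * card S + s" "s < card S" "\<forall>v\<in>S. t \<le> degree E v"
    "s \<le> card {v \<in> S. t < degree E v}"
    using assms(1) unfolding evenly_loaded_def by blast
  have le: "degree E v \<le> degree F v" for v
    using assms by (simp add: degree_mono)
  have "card {v \<in> S. t < degree E v} \<le> card {v \<in> S. t < degree F v}"
    using assms(4) le by (intro card_mono) (auto intro: less_le_trans)
  then show ?thesis
    unfolding evenly_loaded_def using ts le
    by (intro exI[of _ t] exI[of _ s]) (auto intro: le_trans)
qed

text \<open>Counting one more unit may produce a carry: once all of \<open>S\<close> lies above
  \<open>t\<close>, the level becomes \<open>t + 1\<close> and the remainder restarts at 0.\<close>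

lemma evenly_loaded_Suc:
  assumes "finite S" "s < card S" "\<forall>v\<in>S. t \<le> degree E v" "Suc s \<le> card {v \<in> S. t < degree E v}"
  shows "evenly_loaded E S (Suc (t * card S + s))"
proof (cases "Suc s = card S")
  case True
  then have "{v \<in> S. t < degree E v} = S"
    using assms by (intro card_seteq) auto
  then have "\<forall>v\<in>S. Suc t \<le> degree E v"
    by (auto simp: Suc_le_eq)
  then show ?thesis
    unfolding evenly_loaded_def using True assms(2)
    by (intro exI[of _ "Suc t"] exI[of _ 0]) auto
next
  case False
  then show ?thesis
    unfolding evenly_loaded_def using assms
    by (intro exI[of _ t] exI[of _ "Suc s"]) auto
qed

text \<open>Such a vertex decides the game, since Maker can never touch it. The bound
  \<open>v < n\<close> matters: a number outside the vertex set lies on no edge and would qualify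
  vacuously.\<close>

definition saturated :: "nat \<Rightarrow> nat set set \<Rightarrow> nat \<Rightarrow> bool" where
  "saturated n B v \<longleftrightarrow> v < n \<and> {e \<in> complete_edges n. v \<in> e} \<subseteq> B"

text \<open>As Maker has not touched \<open>S\<close>, an edge at a vertex of \<open>S\<close> is
  either Breaker's or free. Hence a vertex of smallest degree can be served unless it is saturated.
  Fewer than \<open>b\<close> edges may be enough, because an edge inside \<open>S\<close> raises
  two degrees.\<close>

lemma increase_load:
  assumes "evenly_loaded B S N" "S \<subseteq> {..<n}" "B \<subseteq> complete_edges n"
    and untouched: "\<And>v e. v \<in> S \<Longrightarrow> e \<in> M \<Longrightarrow> v \<notin> e"
  shows "\<exists>C. C \<subseteq> complete_edges n - (B \<union> M) \<and> card C \<le> b \<and>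
    ((\<exists>v. saturated n (B \<union> C) v) \<or> evenly_loaded (B \<union> C) S (N + b))"
proof (induction b)
  case 0
  then show ?case using assms(1) by (intro exI[of _ "{}"]) auto
next
  case (Suc b)
  then obtain C where C: "C \<subseteq> complete_edges n - (B \<union> M)" "card C \<le> b"
    and win: "(\<exists>v. saturated n (B \<union> C) v) \<or> evenly_loaded (B \<union> C) S (N + b)"
    by blast
  have finS: "finite S"
    using assms(2) finite_subset by blast
  have finB: "finite (B \<union> C)" and finC: "finite C"
    using C(1) assms(3) finite_complete_edges[of n] by (auto intro: finite_subset)
  show ?case
  proof (cases "\<exists>v. saturated n (B \<union> C) v")
    case True
    then show ?thesis using C le_SucI by blast
  next
    case False
    then obtain t s where ts: "N + b = t * card S + s" "s < card S" "\<forall>v\<in>S. t \<le> degree (B \<union> C) v"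
      "s \<le> card {v \<in> S. t < degree (B \<union> C) v}"
      using win unfolding evenly_loaded_def by blast
    show ?thesis
    proof (cases "Suc s \<le> card {v \<in> S. t < degree (B \<union> C) v}")
      \<comment> \<open>The degrees already support one more unit, so the load grows without a new
        edge.\<close>
      case True
      then have "evenly_loaded (B \<union> C) S (N + Suc b)"
        using evenly_loaded_Suc[OF finS ts(2,3)] ts(1) by simp
      then show ?thesis using C le_SucI by blast
    next
      case short: False
      \<comment> \<open>At most \<open>s < card S\<close> vertices exceed \<open>t\<close>, so some
        \<open>v\<close> has degree exactly \<open>t\<close>; the new edge is taken at
        \<open>v\<close>.\<close>
      then have "{v \<in> S. t < degree (B \<union> C) v} \<noteq> S"
        using ts(2) by auto
      then obtain v where v: "v \<in> S" "\<not> t < degree (B \<union> C) v"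
        by blast
      have "\<not> saturated n (B \<union> C) v"
        using False by blast
      then obtain e where e: "e \<in> complete_edges n" "v \<in> e" "e \<notin> B \<union> C"
        using v(1) assms(2) unfolding saturated_def by blast
      have "e \<notin> M"
        using untouched v(1) e(2) by blast
      let ?E = "insert e (B \<union> C)"
      have le: "degree (B \<union> C) w \<le> degree ?E w" for w
        using finB by (intro degree_mono) auto
      have dv: "t < degree ?E v"
        using degree_insert[OF finB e(3,2)] ts(3) v(1) by (simp add: le_imp_less_Suc)
      have "card (insert v {w \<in> S. t < degree (B \<union> C) w}) \<le> card {w \<in> S. t < degree ?E w}"
        using finS v(1) dv le by (intro card_mono) (auto intro: less_le_trans)
      then have "Suc s \<le> card {w \<in> S. t < degree ?E w}"
        using ts(4) v(2) finS by simp
      moreover have "\<forall>w\<in>S. t \<le> degree ?E w"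
        using ts(3) le le_trans by blast
      ultimately have "evenly_loaded ?E S (N + Suc b)"
        using evenly_loaded_Suc[OF finS ts(2)] ts(1) by simp
      then have "evenly_loaded (B \<union> insert e C) S (N + Suc b)"
        by simp
      moreover have "insert e C \<subseteq> complete_edges n - (B \<union> M)"
        using C e \<open>e \<notin> M\<close> by blast
      moreover have "card (insert e C) \<le> Suc b"
        using C(2) finC by (simp add: card_insert_if)
      ultimately show ?thesis by blast
    qed
  qed
qed

text \<open>In the worst case all \<open>d\<close> deleted vertices carry an extra unit, so the
  level \<open>t\<close> survives and the remainder drops by \<open>d\<close>. The average of the
  load is \<open>t\<close> plus remainder over size, and the smaller size only helps a nonnegative
  remainder.\<close>

lemma load_after_deletion:
  assumes "evenly_loaded E S N" "S' \<subseteq> S" "finite S" "card S = card S' + d" "card S' > 0"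
  shows "\<exists>N'. evenly_loaded E S' N' \<and>
    real N' / real (card S') \<ge> (real N - real d) / real (card S)"
proof -
  obtain t s where ts: "N = t * card S + s" "s < card S" "\<forall>v\<in>S. t \<le> degree E v"
    "s \<le> card {v \<in> S. t < degree E v}"
    using assms(1) unfolding evenly_loaded_def by blast
  \<comment> \<open>The subtraction \<open>s - d\<close> is truncated: with \<open>d\<close> at
    least \<open>s\<close>, every extra unit may be lost, but the level \<open>t\<close> is
    not.\<close>
  define N' where "N' = t * card S' + (s - d)"
  have finS': "finite S'"
    using assms finite_subset by blast
  have "card {v \<in> S. t < degree E v} \<le> card ({v \<in> S'. t < degree E v} \<union> (S - S'))"
    using assms by (intro card_mono) (auto intro: finite_subset)
  also have "\<dots> \<le> card {v \<in> S'. t < degree E v} + card (S - S')"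
    by (rule card_Un_le)
  also have "card (S - S') = d"
    using assms finS' by (simp add: card_Diff_subset)
  finally have "s - d \<le> card {v \<in> S'. t < degree E v}"
    using ts(4) by linarith
  then have "evenly_loaded E S' N'"
    unfolding evenly_loaded_def N'_def using ts assms
    by (intro exI[of _ t] exI[of _ "s - d"]) auto
  moreover have "real N' / real (card S') \<ge> (real N - real d) / real (card S)"
  proof -
    have pos: "real (card S') > 0" "real (card S) > 0"
      using assms by auto
    have "(real s - real d) / real (card S) \<le> real (s - d) / real (card S)"
      using pos by (intro divide_right_mono) auto
    also have "\<dots> \<le> real (s - d) / real (card S')"
      using pos assms(4) by (intro divide_left_mono) auto
    finally have "real t + (real s - real d) / real (card S) \<le> real t + real (s - d) / real (card S')"
      by simp
    moreover have "(real N - real d) / real (card S) = real t + (real s - real d) / real (card S)"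
      using pos by (simp add: ts(1) field_simps)
    moreover have "real N' / real (card S') = real t + real (s - d) / real (card S')"
      using pos by (simp add: N'_def field_simps)
    ultimately show ?thesis by simp
  qed
  ultimately show ?thesis by blast
qed

section \<open>Breaker's strategy, given a large enough total gain\<close>

lemma exists_superset_with_card:
  assumes "finite U" "C \<subseteq> U" "card C \<le> b"
  shows "\<exists>C'. C \<subseteq> C' \<and> C' \<subseteq> U \<and> card C' = min b (card U)"
  using exists_subset_between[of C "min b (card U)" U] assms
  by (auto simp: card_mono)

lemma card_touched_le:
  assumes "D \<subseteq> complete_edges n"
  shows "card (\<Union>D) \<le> 2 * card D"
proof -
  have "card (\<Union>D) \<le> sum card D"
    by (rule card_Union_le_sum_card)
  also have "\<dots> = 2 * card D"
    using assms by (simp add: complete_edges_def subset_iff)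
  finally show ?thesis .
qed

text \<open>The hypothesis \<open>r\<close> makes room for the first set of
  \<open>2 * a * r + 1\<close> vertices. By \<open>load\<close>, the degree guaranteed at the last
  vertex and one further move together cover its \<open>n - 1\<close> edges.\<close>

lemma breakers_win_if_load_suffices:
  fixes n a b r :: nat
  assumes n: "n \<ge> 2" and b: "b > 0" and r: "2 * a * r < n"
    and load: "real b + (\<Sum>j=1..r. (real b - 2 * real a) / (2 * real a * real j + 1)) > real n - 2"
  shows "connectivity_game_breakers_win n a b"
proof -
  \<comment> \<open>Lower bound for the growth of the average in a round that starts with
    \<open>2 * a * j + 1\<close> vertices: \<open>b\<close> units gained, \<open>2 * a\<close>
    lost.\<close>
  define gain where "gain = (\<lambda>j. (real b - 2 * real a) / (2 * real a * real j + 1))"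
  define ready where "ready = (\<lambda>i B M. \<exists>S N. S \<subseteq> {..<n} \<and> card S = 2 * a * (r - i) + 1 \<and>
    (\<forall>v\<in>S. \<forall>e\<in>M. v \<notin> e) \<and> evenly_loaded B S N \<and>
    real N / real (card S) \<ge> (\<Sum>j=r - i + 1..r. gain j))"
  \<comment> \<open>The bound \<open>i \<le> r\<close> leaves saturation as the only possibility
    after \<open>Suc r\<close> rounds.\<close>
  define P where "P = (\<lambda>i B M. (\<exists>v. saturated n B v) \<or> i \<le> r \<and> ready i B M)"
  let ?X = "complete_edges n"
  have sat_mono: "saturated n B' v" if "saturated n B v" "B \<subseteq> B'" for B B' v
    using that by (auto simp: saturated_def)
  have "breakers_win ?X (connected_graph {..<n}) a b"
  proof (rule breakers_win_by_invariant[where P = P and R = "Suc r"])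
    show "finite ?X" by (rule finite_complete_edges)
    show "b > 0" by (rule b)
    show "P 0 {} {}"
    proof -
      have "card {..<2 * a * r + 1} = 2 * a * (r - 0) + 1" "{..<2 * a * r + 1} \<subseteq> {..<n}"
        using r by auto
      moreover have "evenly_loaded {} {..<2 * a * r + 1} 0"
        unfolding evenly_loaded_def by (intro exI[of _ 0]) auto
      moreover have "(\<Sum>j=r - 0 + 1..r. gain j) = 0"
        by simp
      ultimately have "ready 0 {} {}"
        unfolding ready_def by (intro exI[of _ "{..<2 * a * r + 1}"] exI[of _ 0]) simp
      then show ?thesis by (simp add: P_def)
    qed
  next
    fix i B M
    assume "P i B M" and BX: "B \<subseteq> ?X" and "M \<subseteq> ?X" and "B \<inter> M = {}"
    let ?U = "?X - (B \<union> M)"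
    have finU: "finite ?U"
      using finite_complete_edges by blast
    \<comment> \<open>It suffices to find the edges that matter; the claim allows any superset
      \<open>C'\<close>, so they can be padded to a move of legal size.\<close>
    have "\<exists>C. C \<subseteq> ?U \<and> card C \<le> b \<and> (\<forall>C' D. C \<subseteq> C' \<longrightarrow> C' \<subseteq> ?U \<longrightarrow>
      D \<subseteq> ?X - (B \<union> M \<union> C') \<longrightarrow> card D \<le> a \<longrightarrow> P (Suc i) (B \<union> C') (M \<union> D))"
    proof (cases "\<exists>v. saturated n B v")
      case True
      then show ?thesis
        unfolding P_def using sat_mono by (intro exI[of _ "{}"]) (simp, blast)
    next
      case False
      then have ir: "i \<le> r" and "ready i B M"
        using \<open>P i B M\<close> by (auto simp: P_def)
      then obtain S N where S: "S \<subseteq> {..<n}" "card S = 2 * a * (r - i) + 1"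
        and free: "\<And>v e. v \<in> S \<Longrightarrow> e \<in> M \<Longrightarrow> v \<notin> e"
        and ev: "evenly_loaded B S N"
        and avg: "real N / real (card S) \<ge> (\<Sum>j=r - i + 1..r. gain j)"
        unfolding ready_def by blast
      have finS: "finite S"
        using S(1) finite_subset by blast
      show ?thesis
      proof (cases "i = r")
        case True
        then obtain v where v: "S = {v}"
          using S(2) by (auto simp: card_1_singleton_iff)
        have "N \<le> degree B v"
          using ev by (auto simp: evenly_loaded_def v)
        moreover have "real N > real n - 2 - real b"
          using avg load True by (simp add: v gain_def)
        \<comment> \<open>The strict real bound is one between integers, hence \<open>n - 2\<close>
          becomes \<open>n - 1\<close>.\<close>
        ultimately have deg: "n - 1 \<le> degree B v + b"
          by linarith
        let ?C = "{e \<in> ?X. v \<in> e} - {e \<in> B. v \<in> e}"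
        have "v < n"
          using S(1) v by simp
        have "card ?C = degree ?X v - degree B v"
          unfolding degree_def using BX finite_complete_edges[of n]
          by (intro card_Diff_subset) (auto intro: finite_subset)
        then have "card ?C \<le> b"
          using deg degree_complete_edges[OF \<open>v < n\<close>] by simp
        moreover have "?C \<subseteq> ?U"
          using free v by auto
        moreover have "saturated n (B \<union> C') v" if "?C \<subseteq> C'" for C'
          using that \<open>v < n\<close> by (auto simp: saturated_def)
        ultimately show ?thesis
          unfolding P_def by (intro exI[of _ ?C]) blast
      next
        case False
        with ir have "i < r" by simp
        obtain C where C: "C \<subseteq> ?U" "card C \<le> b"
          "(\<exists>v. saturated n (B \<union> C) v) \<or> evenly_loaded (B \<union> C) S (N + b)"
          using increase_load[where M = M and b = b, OF ev S(1) BX free] by blast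
        have "P (Suc i) (B \<union> C') (M \<union> D)"
          if C': "C \<subseteq> C'" "C' \<subseteq> ?U" and D: "D \<subseteq> ?X - (B \<union> M \<union> C')" "card D \<le> a" for C' D
        proof (cases "\<exists>v. saturated n (B \<union> C) v")
          case True
          then show ?thesis
            unfolding P_def using sat_mono C'(1) by blast
        next
          case False
          then have "evenly_loaded (B \<union> C) S (N + b)"
            using C(3) by blast
          then have ev': "evenly_loaded (B \<union> C') S (N + b)"
            by (rule evenly_loaded_mono)
              (use C' BX finS finite_complete_edges[of n] in \<open>auto intro: finite_subset\<close>)
          define m' where "m' = 2 * a * (r - Suc i) + 1"
          have m': "card S = m' + 2 * a"
          proof -
            have "r - i = Suc (r - Suc i)"
              using \<open>i < r\<close> by simp
            then show ?thesis
              unfolding S(2) m'_def by simp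
          qed
          have "D \<subseteq> ?X"
            using D(1) by blast
          \<comment> \<open>Maker's edges touch at most \<open>2 * a\<close> vertices, exactly the
            difference between consecutive set sizes, so \<open>m'\<close> untouched ones
            remain.\<close>
          then have "card (\<Union>D) \<le> 2 * a"
            using card_touched_le[of D n] D(2) by linarith
          moreover have "finite (\<Union>D)"
            using D(1) by (intro finite_subset[of "\<Union>D" "{..<n}"]) (auto simp: complete_edges_def)
          ultimately have "m' \<le> card (S - \<Union>D)"
            using diff_card_le_card_Diff[of "\<Union>D" S] m' by simp
          then obtain S' where S': "S' \<subseteq> S - \<Union>D" "card S' = m'"
            by (metis obtain_subset_with_card_n)
          have "S' \<subseteq> S" "card S = card S' + 2 * a" "card S' > 0"
            using S' m' by (auto simp: m'_def)
          then obtain N' where N': "evenly_loaded (B \<union> C') S' N'"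
            "real N' / real (card S') \<ge> (real (N + b) - real (2 * a)) / real (card S)"
            using load_after_deletion[OF ev' _ finS] by blast
          have "(\<Sum>j=r - Suc i + 1..r. gain j) = gain (r - i) + (\<Sum>j=r - i + 1..r. gain j)"
            using \<open>i < r\<close> by (simp add: sum.atLeast_Suc_atMost Suc_diff_Suc)
          also have "\<dots> \<le> gain (r - i) + real N / real (card S)"
            using avg by simp
          also have "\<dots> = (real (N + b) - real (2 * a)) / real (card S)"
            by (simp add: gain_def S(2) add_divide_distrib diff_divide_distrib add.commute)
          also have "\<dots> \<le> real N' / real (card S')"
            by (rule N'(2))
          finally have "ready (Suc i) (B \<union> C') (M \<union> D)"
            unfolding ready_def using S' S(1) N'(1) free
            by (intro exI[of _ S'] exI[of _ N']) (auto simp: m'_def)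
          then show ?thesis
            using \<open>i < r\<close> by (simp add: P_def)
        qed
        then show ?thesis using C by blast
      qed
    qed
    then obtain C where C: "C \<subseteq> ?U" "card C \<le> b" "\<And>C' D. C \<subseteq> C' \<Longrightarrow> C' \<subseteq> ?U \<Longrightarrow>
      D \<subseteq> ?X - (B \<union> M \<union> C') \<Longrightarrow> card D \<le> a \<Longrightarrow> P (Suc i) (B \<union> C') (M \<union> D)"
      by blast
    obtain C' where "C \<subseteq> C'" "C' \<subseteq> ?U" "card C' = min b (card ?U)"
      using exists_superset_with_card[OF finU C(1,2)] by blast
    then show "\<exists>C. C \<subseteq> ?U \<and> card C = min b (card ?U) \<and>
      (\<forall>D. D \<subseteq> ?X - (B \<union> M \<union> C) \<longrightarrow> card D \<le> a \<longrightarrow> P (Suc i) (B \<union> C) (M \<union> D))"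
      using C(3) by (intro exI[of _ C']) auto
  next
    fix i B M
    assume "Suc r \<le> i" "P i B M" and X: "B \<union> M = ?X" and disj: "B \<inter> M = {}"
    then obtain v where v: "saturated n B v"
      by (auto simp: P_def)
    then have "v \<notin> e" if "e \<in> M" for e
      using that X disj by (auto simp: saturated_def)
    moreover have "\<exists>u<n. u \<noteq> v"
      using n by (intro exI[of _ "if v = 0 then 1 else 0"]) auto
    ultimately show "\<not> connected_graph {..<n} M"
      using v not_connected_if_isolated[of v "{..<n}" _ M] by (auto simp: saturated_def)
  qed
  then show ?thesis
    by (simp add: connectivity_game_breakers_win_def)
qed

section \<open>Logarithmic estimates and the choice of \<open>r\<close>\<close>

text \<open>By \<open>ln (1 + x) \<le> x\<close>, each summand dominates
  \<open>ln (c * (j + 1) + 1) - ln (c * j + 1)\<close>, and these differences telescope. Replacing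
  \<open>c + 1\<close> by \<open>c\<close> in the subtracted logarithm costs at most
  \<open>1 / c\<close>.\<close>

lemma ln_le_sum_inverse:
  fixes c :: real
  assumes "c > 0"
  shows "ln (real (Suc r)) - 1 / c \<le> (\<Sum>j=1..r. c / (c * real j + 1))"
proof -
  have "ln (c * real (Suc r) + 1) - ln (c + 1) \<le> (\<Sum>j=1..r. c / (c * real j + 1))"
  proof (induction r)
    case 0
    then show ?case by simp
  next
    case (Suc r)
    let ?x = "c * real (Suc r) + 1"
    have x: "?x > 0" using assms by (simp add: add_pos_nonneg)
    have "1 + c / ?x = (c * real (Suc (Suc r)) + 1) / ?x"
      using x by (simp add: field_simps)
    then have "ln (c * real (Suc (Suc r)) + 1) - ln ?x = ln (1 + c / ?x)"
      using x assms by (simp only: ln_divide_pos mult_pos_pos of_nat_0_less_iff zero_less_Suc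
          add_pos_pos zero_less_one)
    also have "\<dots> \<le> c / ?x"
      using x assms by (intro ln_add_one_self_le_self) auto
    finally show ?case using Suc by simp
  qed
  moreover have "ln (c * real (Suc r) + 1) \<ge> ln c + ln (real (Suc r))"
  proof -
    have "ln c + ln (real (Suc r)) = ln (c * real (Suc r))"
      using assms by (simp only: ln_mult_pos of_nat_0_less_iff zero_less_Suc)
    also have "\<dots> \<le> ln (c * real (Suc r) + 1)"
      using assms by (intro ln_mono) (simp_all only: mult_pos_pos of_nat_0_less_iff zero_less_Suc)
    finally show ?thesis .
  qed
  moreover have "ln (c + 1) - ln c \<le> 1 / c"
  proof -
    have "1 + 1 / c = (c + 1) / c"
      using assms by (simp add: field_simps)
    then have "ln (c + 1) - ln c = ln (1 + 1 / c)"
      using assms by (simp only: ln_divide_pos add_pos_pos zero_less_one)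
    also have "\<dots> \<le> 1 / c"
      using assms by (intro ln_add_one_self_le_self) auto
    finally show ?thesis .
  qed
  ultimately show ?thesis by linarith
qed

theorem theorem1p2:
  fixes \<epsilon> :: real and n a b :: nat
  assumes "\<epsilon> > 0" and "n > 0" and "a > 0" and "b > 0"
    and "(1 + \<epsilon>) * ln (real n) \<le> real a"
    and "real a < real n / (2 * exp 1)"
    and "real b \<ge>
      (2 * real a * (real n - 2 + ln (real_of_int \<lceil>real n / (2 * real a)\<rceil>))
          + ln (real_of_int \<lceil>real n / (2 * real a)\<rceil>) - 1 + 2 * real a / real n)
      / (2 * real a + ln (real_of_int \<lceil>real n / (2 * real a)\<rceil>) - 1 + 2 * real a / real n)"
  shows "connectivity_game_breakers_win n a b"
proof -
  \<comment> \<open>The largest integer strictly below \<open>n / (2 * a)\<close>, so that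
    \<open>2 * a * r < n\<close> while \<open>Suc r\<close> is the ceiling in the bound on
    \<open>b\<close>.\<close>
  define r where "r = nat (\<lceil>real n / (2 * real a)\<rceil> - 1)"
  define L where "L = ln (real (Suc r))"
  have a1: "real a \<ge> 1" using \<open>a > 0\<close> by simp
  have e2: "exp 1 \<ge> (2 :: real)"
    using exp_ge_add_one_self[of 1] by simp
  have na: "real n / (2 * real a) > exp 1"
    using assms(6) a1 by (simp add: field_simps)
  have n4: "real n > 4 * real a"
  proof -
    have "real n > exp 1 * (2 * real a)"
      using na a1 by (simp add: field_simps)
    moreover have "exp 1 * (2 * real a) \<ge> 2 * (2 * real a)"
      using e2 a1 by (intro mult_right_mono) auto
    ultimately show ?thesis by linarith
  qed
  have ceil_pos: "\<lceil>real n / (2 * real a)\<rceil> \<ge> 1"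
    using na e2 by linarith
  have k: "real (Suc r) = real_of_int \<lceil>real n / (2 * real a)\<rceil>"
    using ceil_pos by (simp add: r_def)
  have r_less: "real r < real n / (2 * real a)"
    using k by linarith
  then have "real (2 * a * r) < real n"
    using a1 by (simp add: field_simps)
  then have rn: "2 * a * r < n"
    by (simp only: of_nat_less_iff)
  have "exp 1 \<le> real (Suc r)"
    using na k by linarith
  then have L1: "L \<ge> 1"
    unfolding L_def by (subst ln_ge_iff) auto
  have "1 * r \<le> 2 * a * r"
    using \<open>a > 0\<close> by (intro mult_le_mono1) simp
  then have "r < n"
    using rn by linarith
  then have "L \<le> ln (real n)"
    unfolding L_def by (intro ln_mono) auto
  also have "\<dots> \<le> (1 + \<epsilon>) * ln (real n)"
    using \<open>\<epsilon> > 0\<close> \<open>n > 0\<close> by (simp add: mult_le_cancel_right1)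
  finally have La: "L \<le> real a"
    using assms(5) by linarith
  define q where "q = 2 * real a / real n"
  have q: "0 < q" "q \<le> 1 / 2"
    using n4 a1 by (auto simp: q_def field_simps)
  have "real b \<ge> (2 * real a * (real n - 2 + L) + L - 1 + q) / (2 * real a + L - 1 + q)"
    using assms(7) unfolding L_def k q_def by simp
  then have bound: "2 * real a * (real n - 2 + L) + L - 1 + q \<le> real b * (2 * real a + L - 1 + q)"
    using a1 L1 q by (simp add: field_simps)
  \<comment> \<open>The denominator in the bound on \<open>b\<close> is at most \<open>3 * a\<close>
    because \<open>L \<le> a\<close>, and the numerator is at least \<open>2 * a * (n - 1)\<close>.
    This makes the factor \<open>b - 2 * a\<close> nonnegative, as needed to multiply the estimate
    for \<open>H\<close> by it.\<close>
  have b2a: "real b \<ge> 2 * real a"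
  proof -
    have "real b * (2 * real a + L - 1 + q) \<le> real b * (3 * real a)"
      using La q by (intro mult_left_mono) auto
    moreover have "2 * real a * (real n - 2 + L) \<ge> 2 * real a * (real n - 1)"
      using L1 a1 by (intro mult_left_mono) auto
    ultimately have "real a * (2 * (real n - 1)) \<le> real a * (3 * real b)"
      using bound L1 q by (simp add: algebra_simps)
    then have "2 * (real n - 1) \<le> 3 * real b"
      using a1 by (subst (asm) mult_le_cancel_left_pos) auto
    then have "3 * real b \<ge> 2 * real n - 2"
      by simp
    moreover have "2 * real n - 2 \<ge> 6 * real a"
      using n4 a1 by simp
    ultimately show ?thesis by simp
  qed
  define H where "H = (\<Sum>j=1..r. 2 * real a / (2 * real a * real j + 1))"
  have "1 / (2 * real a) \<le> 1 / 2"
    using a1 by simp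
  then have H: "H \<ge> L - 1 / 2"
    using ln_le_sum_inverse[of "2 * real a" r] a1 unfolding H_def L_def by linarith
  have "(real b - 2 * real a) * (L - 1 / 2) \<le> (real b - 2 * real a) * H"
    using H b2a by (intro mult_left_mono) auto
  moreover have "(real b - 1) * q \<le> (real b - 1) * (1 / 2)"
    using q \<open>b > 0\<close> by (intro mult_left_mono) auto
  \<comment> \<open>With \<open>H\<close> replaced by \<open>L - 1 / 2\<close>, the terms in
    \<open>b * L\<close> and \<open>a * L\<close> cancel. The excess over
    \<open>2 * a * (n - 2)\<close> is at least \<open>(L - 1) + a + b / 2 - (b - 1) * q\<close>,
    positive since \<open>q \<le> 1 / 2\<close>.\<close>
  ultimately have "2 * real a * real b + (real b - 2 * real a) * H > 2 * real a * (real n - 2)"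
    using bound L1 a1 by (simp add: algebra_simps)
  then have "real b + (real b - 2 * real a) * H / (2 * real a) > real n - 2"
    using a1 by (simp add: field_simps)
  moreover have "(real b - 2 * real a) * H / (2 * real a)
      = (\<Sum>j=1..r. (real b - 2 * real a) / (2 * real a * real j + 1))"
    unfolding H_def sum_distrib_left sum_divide_distrib
    using a1 by (intro sum.cong) simp_all
  ultimately show ?thesis
    using n4 a1 rn \<open>b > 0\<close> by (intro breakers_win_if_load_suffices[of n b a r]) auto
qed

end
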